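(* Let $g=(t,z_0,c_0)\in G$ be such that $\alpha_k(t)\notin\pi+2\pi\mathbb Z$ for each $k=1,\dots,n$. Then, for each $z\in\mathbb C^n$, $$W_0(\pi(g))(z)=2^n\chi(t)e^{i\lambda c_0}\,\mathrm{Det}(I_n+A(t^{-1}))^{-1}\exp\left(-\lambda(t^{-1}\cdot z_0)\bar z-\lambda|z|^2-\tfrac\lambda4|z_0|^2\right)\exp\left(\tfrac\lambda2(t^{-1}\cdot z_0+2z)(I_n+A(t))^{-1}(\overline{t^{-1}\cdot z_0+2z})\right),$$ and, equivalently, $$W_0(\pi(g))(z)=2^n\chi(t)e^{i\lambda c_0}\exp\left(-\lambda(t^{-1}\cdot z_0)\bar z-\lambda|z|^2-\tfrac\lambda4|z_0|^2\right)\prod_{k=1}^n(1+e^{-i\alpha_k(t)})^{-1}\exp\left(\tfrac\lambda2\sum_{k=1}^n(1+e^{i\alpha_k(t)})^{-1}\bigl|e^{-i\alpha_k(t)}a_k+2z_k\bigr|^2\right)$$ where $z_0=(a_1,a_2,\dots,a_n)$.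
   Context: Fix integers $n,m\ge 1$ and $\lambda>0$. For $z,w\in\mathbb C^n$ put $zw:=\sum_k z_kw_k$ (bilinear), $|z|^2=z\bar z$, and $\omega((z,w),(z',w')):=\tfrac i2(zw'-z'w)$. Let $\alpha_1,\dots,\alpha_n$ be linear forms on $\mathbb R^m$, $A(t):=\mathrm{Diag}(e^{i\alpha_1(t)},\dots,e^{i\alpha_n(t)})$ and $t\cdot z=A(t)z$ for $t\in\mathbb R^m$; $t^{-1}$ means $-t$. For an $n\times n$ matrix $M$, $zMw$ denotes $\sum_{j,k}z_jM_{jk}w_k$. The generalized diamond group $G$ is $\mathbb R^m\times\mathbb C^n\times\mathbb R$ with $(t,z,c)\cdot(t',z',c')=(t+t',\,z+t\cdot z',\,c+c'+\tfrac12\omega((z,\bar z),(t\cdot z',\overline{t\cdot z'})))$. $\mathcal F_\lambda$ is the Hilbert space of holomorphic $f$ on $\mathbb C^n$ with $\int_{\mathbb C^n}|f(z)|^2e^{-\lambda|z|^2/2}d\mu_\lambda(z)<\infty$, $d\mu_\lambda=(2\pi)^{-n}\lambda^n\,dx\,dy$, $z=x+iy$. Fix a unitary character $\chi$ of $\mathbb R^m$; the unitary representation $\pi$ of $G$ on $\mathcal F_\lambda$ is $(\pi(t,z_0,c_0)f)(z)=\chi(t)\exp(i\lambda c_0+\tfrac\lambda2\bar z_0z-\tfrac\lambda4|z_0|^2)f(t^{-1}\cdot(z-z_0))$. Coherent states: $e_z(w)=\exp(\lambda\bar zw/2)$. The kernel of an operator $B$ is $k_B(z,w)=\langle Be_w,e_z\rangle$.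 The complex Weyl symbol of $B$ is defined, whenever the integral converges, by $$W_0(B)(z)=2^n\int_{\mathbb C^n}k_B(z+w,z-w)\exp\left(\tfrac\lambda2(-z\bar z-w\bar w+z\bar w-\bar zw)\right)d\mu_\lambda(w).$$ *)

theory Defs
  imports "HOL-Analysis.Analysis" "HOL-Algebra.Group"
begin

text \<open>
  The space \<open>C\<^sup>n\<close> is \<^typ>\<open>complex^'n\<close> and \<open>R\<^sup>m\<close> is \<^typ>\<open>real^'m\<close>, for finite (hence nonempty) index
  types. The parameter lambda is written \<open>lam\<close>.
\<close>

definition bil :: "complex^'n \<Rightarrow> complex^'n \<Rightarrow> complex" (infixl "\<odot>" 70)
  where "z \<odot> w = (\<Sum>k\<in>UNIV. z $ k * w $ k)"

definition vcnj :: "complex^'n \<Rightarrow> complex^'n"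
  where "vcnj z = (\<chi> k. cnj (z $ k))"

lemma bil_vcnj_self: "z \<odot> vcnj z = complex_of_real ((norm z)\<^sup>2)"
  by (simp add: bil_def vcnj_def norm_vec_def L2_set_def sum_nonneg
      complex_norm_square[symmetric] flip: of_real_power)

definition bil_mat :: "complex^'n \<Rightarrow> complex^'n^'n \<Rightarrow> complex^'n \<Rightarrow> complex"
  where "bil_mat z M w = (\<Sum>j\<in>UNIV. \<Sum>k\<in>UNIV. z $ j * M $ j $ k * w $ k)"

definition omega :: "(complex^'n) \<times> (complex^'n) \<Rightarrow> (complex^'n) \<times> (complex^'n) \<Rightarrow> complex"
  where "omega p q = \<i> / 2 * (fst p \<odot> snd q - fst q \<odot> snd p)"

definition Amat :: "('n \<Rightarrow> real^'m \<Rightarrow> real) \<Rightarrow> real^'m \<Rightarrow> complex^'n^'n"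
  where "Amat \<alpha> t = (\<chi> j k. if j = k then exp (\<i> * complex_of_real (\<alpha> j t)) else 0)"

definition act :: "('n \<Rightarrow> real^'m \<Rightarrow> real) \<Rightarrow> real^'m \<Rightarrow> complex^'n \<Rightarrow> complex^'n"
  where "act \<alpha> t z = Amat \<alpha> t *v z"

text \<open>
  On pairs \<open>(z, vcnj z)\<close> the form \<^const>\<open>omega\<close> takes real values (lemma \<open>Im_omega_vcnj\<close>), so that the
  real part below only changes the type.
\<close>

definition diamond_group ::
  "('n \<Rightarrow> real^'m \<Rightarrow> real) \<Rightarrow> ((real^'m) \<times> (complex^'n) \<times> real) monoid"
  where "diamond_group \<alpha> =
    \<lparr>carrier = UNIV,
     mult = (\<lambda>(t, z, c) (t', z', c').
       (t + t', z + act \<alpha> t z',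
        c + c' + 1/2 * Re (omega (z, vcnj z) (act \<alpha> t z', vcnj (act \<alpha> t z'))))),
     one = (0, 0, 0)\<rparr>"

lemma Im_omega_vcnj: "Im (omega (z, vcnj z) (w, vcnj w)) = 0"
  by (simp add: omega_def bil_def vcnj_def mult.commute)

lemma act_nth: "act \<alpha> t z $ k = exp (\<i> * complex_of_real (\<alpha> k t)) * z $ k"
  by (simp add: act_def Amat_def matrix_vector_mult_def if_distrib[where f="\<lambda>x. x * _"] cong: if_cong)

lemma group_diamond_group:
  fixes \<alpha> :: "'n::finite \<Rightarrow> real^'m \<Rightarrow> real"
  assumes lin: "\<And>k. linear (\<alpha> k)"
  shows "group (diamond_group \<alpha>)"
proof (rule groupI)
  have add: "act \<alpha> (s + t) z = act \<alpha> s (act \<alpha> t z)" for s t and z :: "complex^'n"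
    by (simp add: vec_eq_iff act_nth linear_add[OF lin] distrib_left exp_add)
  have zero: "act \<alpha> 0 z = z" for z :: "complex^'n"
    by (simp add: vec_eq_iff act_nth linear_0[OF lin])
  have plus: "act \<alpha> t (z + w) = act \<alpha> t z + act \<alpha> t w" for t and z w :: "complex^'n"
    by (simp add: act_def matrix_vector_right_distrib)
  have act0: "act \<alpha> t 0 = 0" for t
    by (simp add: act_def)
  define om where "om z w = Re (omega (z, vcnj z) (w, vcnj w))" for z w :: "complex^'n"
  have om_eq: "om z w = (\<Sum>k\<in>UNIV. Im (cnj (z $ k) * w $ k))" for z w
    unfolding om_def omega_def bil_def vcnj_def fst_conv snd_conv sum_subtractf[symmetric]
      sum_distrib_left Re_sum
    by (intro sum.cong refl) simp
  have om_l: "om (x + y) z = om x z + om y z" and om_r: "om z (x + y) = om z x + om z y" for x y z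
    by (simp_all add: om_eq sum.distrib[symmetric] algebra_simps)
  have om_0: "om 0 z = 0" "om z 0 = 0" for z
    by (simp_all add: om_eq)
  have om_self: "om (- z) z = 0" for z
    by (simp add: om_eq)
  have om_act: "om (act \<alpha> t z) (act \<alpha> t w) = om z w" for t z w
  proof -
    have "cnj (act \<alpha> t z $ k) * act \<alpha> t w $ k = cnj (z $ k) * w $ k" for k
    proof -
      have "cnj (exp (\<i> * complex_of_real (\<alpha> k t))) * exp (\<i> * complex_of_real (\<alpha> k t)) = 1"
        by (simp add: exp_cnj exp_add[symmetric])
      then show ?thesis
        by (simp add: act_nth mult_ac) 
    qed
    then show ?thesis by (simp add: om_eq)
  qed
  note defs = diamond_group_def om_def[symmetric]
  show "x \<otimes>\<^bsub>diamond_group \<alpha>\<^esub> y \<in> carrier (diamond_group \<alpha>)" for x y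
    by (simp add: defs)
  show "\<one>\<^bsub>diamond_group \<alpha>\<^esub> \<in> carrier (diamond_group \<alpha>)"
    by (simp add: defs)
  show "x \<otimes>\<^bsub>diamond_group \<alpha>\<^esub> y \<otimes>\<^bsub>diamond_group \<alpha>\<^esub> z =
      x \<otimes>\<^bsub>diamond_group \<alpha>\<^esub> (y \<otimes>\<^bsub>diamond_group \<alpha>\<^esub> z)" for x y z
    by (cases x; cases y; cases z) (simp add: defs add plus om_l om_r om_act add_divide_distrib algebra_simps)
  show "\<one>\<^bsub>diamond_group \<alpha>\<^esub> \<otimes>\<^bsub>diamond_group \<alpha>\<^esub> x = x" for x
    by (cases x) (simp add: defs zero om_0)
  show "\<exists>y\<in>carrier (diamond_group \<alpha>). y \<otimes>\<^bsub>diamond_group \<alpha>\<^esub> x = \<one>\<^bsub>diamond_group \<alpha>\<^esub>" for x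
  proof -
    obtain t z c where x: "x = (t, z, c)" by (cases x)
    show ?thesis
      by (rule bexI[of _ "(- t, - act \<alpha> (- t) z, - c)"]) (simp_all add: x defs om_self)
  qed
qed

definition unitary_character :: "(real^'m \<Rightarrow> complex) \<Rightarrow> bool"
  where "unitary_character chi \<longleftrightarrow>
    continuous_on UNIV chi \<and> (\<forall>s t. chi (s + t) = chi s * chi t) \<and> (\<forall>t. norm (chi t) = 1)"

text \<open>Holomorphy in several variables: the real Frechet derivative exists and is complex-linear.\<close>

definition holomorphic_Cn :: "(complex^'n \<Rightarrow> complex) \<Rightarrow> bool"
  where "holomorphic_Cn f \<longleftrightarrow>
    (\<forall>z. \<exists>D. (f has_derivative D) (at z) \<and> (\<forall>c v. D (c *s v) = c * D v))"

text \<open>The measure \<open>dx dy\<close> on \<open>C\<^sup>n\<close> is \<^const>\<open>lborel\<close>.\<close>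

definition mu :: "real \<Rightarrow> (complex^'n) measure"
  where "mu lam = density lborel (\<lambda>_. ennreal ((2 * pi) powi (- int CARD('n)) * lam ^ CARD('n)))"

definition fock :: "real \<Rightarrow> (complex^'n \<Rightarrow> complex) set"
  where "fock lam = {f. holomorphic_Cn f \<and>
    integrable (mu lam) (\<lambda>z. (norm (f z))\<^sup>2 * exp (- lam * (norm z)\<^sup>2 / 2))}"

definition fock_inner ::
  "real \<Rightarrow> (complex^'n \<Rightarrow> complex) \<Rightarrow> (complex^'n \<Rightarrow> complex) \<Rightarrow> complex"
  where "fock_inner lam f g =
    (LINT z|mu lam. f z * cnj (g z) * complex_of_real (exp (- lam * (norm z)\<^sup>2 / 2)))"

text \<open>
  Operators on the Fock space are functions with domain \<^term>\<open>fock lam\<close>; outside this domain they are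
  left undefined by \<^const>\<open>restrict\<close>.
\<close>

definition pi_rep ::
  "('n \<Rightarrow> real^'m \<Rightarrow> real) \<Rightarrow> (real^'m \<Rightarrow> complex) \<Rightarrow> real \<Rightarrow> (real^'m) \<times> (complex^'n) \<times> real
    \<Rightarrow> (complex^'n \<Rightarrow> complex) \<Rightarrow> complex^'n \<Rightarrow> complex"
  where "pi_rep \<alpha> chi lam = (\<lambda>(t, z0, c0). \<lambda>f\<in>fock lam. \<lambda>z.
    chi t * exp (\<i> * lam * c0 + lam / 2 * (vcnj z0 \<odot> z) - lam / 4 * (norm z0)\<^sup>2)
      * f (act \<alpha> (- t) (z - z0)))"

definition coherent :: "real \<Rightarrow> complex^'n \<Rightarrow> complex^'n \<Rightarrow> complex"
  where "coherent lam z = (\<lambda>w. exp (lam * (vcnj z \<odot> w) / 2))"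

definition op_kernel ::
  "real \<Rightarrow> ((complex^'n \<Rightarrow> complex) \<Rightarrow> complex^'n \<Rightarrow> complex) \<Rightarrow> complex^'n \<Rightarrow> complex^'n \<Rightarrow> complex"
  where "op_kernel lam B z w = fock_inner lam (B (coherent lam w)) (coherent lam z)"

definition weyl_integrand ::
  "real \<Rightarrow> ((complex^'n \<Rightarrow> complex) \<Rightarrow> complex^'n \<Rightarrow> complex) \<Rightarrow> complex^'n \<Rightarrow> complex^'n \<Rightarrow> complex"
  where "weyl_integrand lam B z w = op_kernel lam B (z + w) (z - w) *
    exp (lam / 2 * (- (z \<odot> vcnj z) - w \<odot> vcnj w + z \<odot> vcnj w - vcnj z \<odot> w))"

definition weyl_defined ::
  "real \<Rightarrow> ((complex^'n \<Rightarrow> complex) \<Rightarrow> complex^'n \<Rightarrow> complex) \<Rightarrow> complex^'n \<Rightarrow> bool"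
  where "weyl_defined lam B z \<longleftrightarrow> integrable (mu lam) (weyl_integrand lam B z)"

definition W0 ::
  "real \<Rightarrow> ((complex^'n \<Rightarrow> complex) \<Rightarrow> complex^'n \<Rightarrow> complex) \<Rightarrow> complex^'n \<Rightarrow> complex"
  where "W0 lam B z = 2 ^ CARD('n) * (LINT w|mu lam. weyl_integrand lam B z w)"

end

theory Submission
  imports Defs "HOL-Probability.Distributions"
begin

text \<open>
  Both the kernel of \<open>\<pi>(g)\<close> and its Weyl symbol are integrals over \<open>C\<^sup>n\<close> of
  \<open>exp (\<lambda>/2 \<Sum>\<^sub>k (b\<^sub>k w\<^sub>k + c\<^sub>k cnj w\<^sub>k - s\<^sub>k |w\<^sub>k|\<^sup>2))\<close>, with \<open>s\<^sub>k = 1\<close> for the kernel and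
  \<open>s\<^sub>k = 1 + exp (- i \<alpha>\<^sub>k(t))\<close> for the symbol; the condition on \<open>\<alpha>\<^sub>k(t)\<close> says precisely that
  \<open>Re s\<^sub>k > 0\<close>. Such an integral factorises over the \<open>2n\<close> real coordinates into one-dimensional
  integrals of \<open>exp (b x - s x\<^sup>2)\<close> with complex \<open>b\<close> and \<open>s\<close>. Integrating by parts gives
  differential equations in \<open>b\<close> and in \<open>s\<close>, which determine them from the real case.
\<close>

subsection \<open>Gaussian integrals with complex parameters\<close>

text \<open>Dominated convergence applied to difference quotients along an arbitrary sequence
  tending to \<open>z\<close>. Convexity of \<open>S\<close> is there for the mean value inequality,
  which turns the bound on \<open>f'\<close> into the same bound on the quotients.\<close>

lemma has_field_derivative_lebesgue_integral:
  fixes f f' :: "complex \<Rightarrow> 'a \<Rightarrow> complex"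
  assumes S: "open S" "convex S" "z \<in> S"
    and deriv: "\<And>w x. w \<in> S \<Longrightarrow> x \<in> space M \<Longrightarrow> ((\<lambda>w. f w x) has_field_derivative f' w x) (at w)"
    and int: "\<And>w. w \<in> S \<Longrightarrow> integrable M (f w)"
    and meas: "f' z \<in> borel_measurable M"
    and bound: "\<And>w x. w \<in> S \<Longrightarrow> x \<in> space M \<Longrightarrow> norm (f' w x) \<le> g x"
    and g: "integrable M g"
  shows "((\<lambda>w. \<integral>x. f w x \<partial>M) has_field_derivative (\<integral>x. f' z x \<partial>M)) (at z)"
proof -
  have "((\<lambda>w. ((\<integral>x. f w x \<partial>M) - (\<integral>x. f z x \<partial>M)) / (w - z)) \<longlongrightarrow> (\<integral>x. f' z x \<partial>M)) (at z within S)"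
    unfolding tendsto_at_iff_sequentially
  proof (intro allI impI)
    fix X assume X: "\<forall>i. X i \<in> S - {z}" "X \<longlonglongrightarrow> z"
    have "(\<lambda>i. \<integral>x. (f (X i) x - f z x) / (X i - z) \<partial>M) \<longlonglongrightarrow> (\<integral>x. f' z x \<partial>M)"
    proof (rule integral_dominated_convergence[where w = g])
      show "(\<lambda>x. (f (X i) x - f z x) / (X i - z)) \<in> borel_measurable M" for i
        using X S int by (intro borel_measurable_divide borel_measurable_diff) auto
      show "AE x in M. (\<lambda>i. (f (X i) x - f z x) / (X i - z)) \<longlonglongrightarrow> f' z x"
      proof (rule AE_I2)
        fix x assume "x \<in> space M"
        then have "((\<lambda>w. (f w x - f z x) / (w - z)) \<longlongrightarrow> f' z x) (at z within S)"
          using deriv[OF S(3), of x] by (simp add: has_field_derivative_iff at_within_open[OF S(3,1)])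
        then show "(\<lambda>i. (f (X i) x - f z x) / (X i - z)) \<longlonglongrightarrow> f' z x"
          using X unfolding tendsto_at_iff_sequentially by (auto simp: o_def)
      qed
      show "AE x in M. norm ((f (X i) x - f z x) / (X i - z)) \<le> g x" for i
      proof (rule AE_I2)
        fix x assume x: "x \<in> space M"
        have "norm (f (X i) x - f z x) \<le> g x * norm (X i - z)"
          using X S by (intro field_differentiable_bound[OF S(2), where f' = "\<lambda>w. f' w x"])
            (auto intro: has_field_derivative_at_within[OF deriv] bound x)
        then show "norm ((f (X i) x - f z x) / (X i - z)) \<le> g x"
          using X by (auto simp: norm_divide divide_simps)
      qed
    qed (use meas g in auto)
    also have "(\<lambda>i. \<integral>x. (f (X i) x - f z x) / (X i - z) \<partial>M) =
        ((\<lambda>w. ((\<integral>x. f w x \<partial>M) - (\<integral>x. f z x \<partial>M)) / (w - z)) \<circ> X)"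
      using X S int by (auto simp: fun_eq_iff)
    finally show "((\<lambda>w. ((\<integral>x. f w x \<partial>M) - (\<integral>x. f z x \<partial>M)) / (w - z)) \<circ> X) \<longlonglongrightarrow> (\<integral>x. f' z x \<partial>M)" .
  qed
  then show ?thesis
    by (simp add: has_field_derivative_iff at_within_open[OF S(3,1)])
qed

section \<open>Integrability and decay of one-dimensional Gaussians\<close>

lemma integrable_exp_neg_square:
  fixes d :: real
  assumes "d > 0"
  shows "integrable lborel (\<lambda>x. exp (- d * x\<^sup>2))"
proof -
  \<comment> \<open>The normal density of variance \<open>1 / (2 * d)\<close>, with its normalising
    constant removed.\<close>
  have "integrable lborel (\<lambda>x. sqrt (pi / d) * normal_density 0 (sqrt (1 / (2 * d))) x)"
    using assms by (intro integrable_mult_right integrable_normal_density) auto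
  also have "(\<lambda>x. sqrt (pi / d) * normal_density 0 (sqrt (1 / (2 * d))) x) = (\<lambda>x. exp (- d * x\<^sup>2))"
    using assms by (auto simp: normal_density_def fun_eq_iff field_simps)
  finally show ?thesis .
qed

text \<open>Half of the quadratic decay absorbs both the power of \<open>x\<close> and the linear
  term. The bound depends only on \<open>k\<close>, \<open>d\<close> and \<open>B\<close>, hence is
  uniform over \<open>Re s \<ge> d\<close> and \<open>norm b \<le> B\<close>; this is what makes it
  usable as a dominating function when \<open>b\<close> or \<open>s\<close> varies.\<close>

lemma norm_gaussian_le:
  fixes s b :: complex and x d :: real
  assumes d: "0 < d" "d \<le> Re s" and b: "norm b \<le> B"
  shows "norm (of_real x ^ k * exp (b * of_real x - s * of_real x ^ 2))
    \<le> fact k * exp ((B + 1)\<^sup>2 / (2 * d)) * exp (- (d / 2) * x\<^sup>2)"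
proof -
  \<comment> \<open>A single term of the exponential series of \<open>|x|\<close> is at most the
    whole sum. The extra factor \<open>exp |x|\<close> is the reason for \<open>B + 1\<close> in
    place of \<open>B\<close> below.\<close>
  have "(\<Sum>n\<in>{k}. \<bar>x\<bar> ^ n /\<^sub>R fact n) \<le> exp \<bar>x\<bar>"
    unfolding exp_def by (rule sum_le_suminf[OF summable_exp_generic]) auto
  then have k: "\<bar>x\<bar> ^ k \<le> fact k * exp \<bar>x\<bar>"
    by (simp add: field_simps)
  have "Re b * x \<le> B * \<bar>x\<bar>"
  proof -
    have "Re b * x \<le> \<bar>Re b\<bar> * \<bar>x\<bar>"
      by (metis abs_ge_self abs_mult)
    also have "\<dots> \<le> B * \<bar>x\<bar>"
      using b abs_Re_le_cmod[of b] by (intro mult_right_mono) auto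
    finally show ?thesis .
  qed
  moreover have "d * x\<^sup>2 \<le> Re s * x\<^sup>2"
    using d by (intro mult_right_mono) auto
  moreover have "(B + 1) * \<bar>x\<bar> \<le> (B + 1)\<^sup>2 / (2 * d) + (d / 2) * x\<^sup>2"
  proof -
    have "0 \<le> (d * \<bar>x\<bar> - (B + 1))\<^sup>2" by simp
    also have "\<dots> = d\<^sup>2 * x\<^sup>2 + (B + 1)\<^sup>2 - 2 * d * (B + 1) * \<bar>x\<bar>"
      by (simp add: power2_eq_square algebra_simps abs_mult_self_eq)
    finally show ?thesis
      using d by (simp add: field_simps power2_eq_square)
  qed
  ultimately have "\<bar>x\<bar> + (- Re s * x\<^sup>2 + Re b * x) \<le> (B + 1)\<^sup>2 / (2 * d) + - (d / 2) * x\<^sup>2"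
    by (simp add: algebra_simps)
  then have e: "exp \<bar>x\<bar> * exp (- Re s * x\<^sup>2 + Re b * x) \<le> exp ((B + 1)\<^sup>2 / (2 * d)) * exp (- (d / 2) * x\<^sup>2)"
    by (simp only: exp_add[symmetric] exp_le_cancel_iff)
  have "norm (of_real x ^ k * exp (b * of_real x - s * of_real x ^ 2)) = \<bar>x\<bar> ^ k * exp (- Re s * x\<^sup>2 + Re b * x)"
    by (simp add: norm_mult norm_power power2_eq_square)
  also have "\<dots> \<le> fact k * exp \<bar>x\<bar> * exp (- Re s * x\<^sup>2 + Re b * x)"
    using k by (intro mult_right_mono) auto
  also have "\<dots> \<le> fact k * (exp ((B + 1)\<^sup>2 / (2 * d)) * exp (- (d / 2) * x\<^sup>2))"
    unfolding mult.assoc using e by (intro mult_left_mono) auto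
  finally show ?thesis by (simp add: mult_ac)
qed

text \<open>Powers of \<open>x\<close> are included because differentiating in \<open>b\<close>
  raises \<open>k\<close> by one, and differentiating in \<open>s\<close> raises it by two with a
  change of sign.\<close>

definition gaussian_moment :: "nat \<Rightarrow> complex \<Rightarrow> complex \<Rightarrow> complex"
  where "gaussian_moment k s b = (LBINT x. of_real x ^ k * exp (b * of_real x - s * of_real x ^ 2))"

lemma integrable_gaussian:
  assumes "Re s > 0"
  shows "integrable lborel (\<lambda>x. of_real x ^ k * exp (b * of_real x - s * of_real x ^ 2) :: complex)"
proof (rule Bochner_Integration.integrable_bound)
  show "integrable lborel (\<lambda>x. fact k * exp ((norm b + 1)\<^sup>2 / (2 * Re s)) * exp (- (Re s / 2) * x\<^sup>2))"
    using assms by (intro integrable_mult_right integrable_exp_neg_square) auto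
  show "AE x in lborel. norm (of_real x ^ k * exp (b * of_real x - s * of_real x ^ 2))
      \<le> norm (fact k * exp ((norm b + 1)\<^sup>2 / (2 * Re s)) * exp (- (Re s / 2) * x\<^sup>2))"
    using norm_gaussian_le[OF assms order_refl order_refl, of _ k b] by (intro AE_I2) (auto simp del: fact_Suc)
qed measurable

text \<open>Stated for any filter along which the square tends to infinity, so that it covers both
  ends of the real line.\<close>

lemma gaussian_tendsto_0:
  assumes "Re s > 0" and F: "filterlim (\<lambda>x::real. x\<^sup>2) at_top F"
  shows "((\<lambda>x. of_real x ^ k * exp (b * of_real x - s * of_real x ^ 2) :: complex) \<longlongrightarrow> 0) F"
proof (rule Lim_null_comparison)
  show "\<forall>\<^sub>F x in F. norm (of_real x ^ k * exp (b * of_real x - s * of_real x ^ 2))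
      \<le> fact k * exp ((norm b + 1)\<^sup>2 / (2 * Re s)) * exp (- (Re s / 2) * x\<^sup>2)"
    using norm_gaussian_le[OF assms(1) order_refl order_refl] by simp
  have "filterlim (\<lambda>x. - (Re s / 2) * x\<^sup>2) at_bot F"
    by (rule filterlim_tendsto_neg_mult_at_bot[OF tendsto_const _ F]) (use assms in auto)
  then have "((\<lambda>x. exp (- (Re s / 2) * x\<^sup>2)) \<longlongrightarrow> 0) F"
    by (rule filterlim_compose[OF exp_at_bot])
  then show "((\<lambda>x. fact k * exp ((norm b + 1)\<^sup>2 / (2 * Re s)) * exp (- (Re s / 2) * x\<^sup>2)) \<longlongrightarrow> 0) F"
    by (rule tendsto_mult_right_zero)
qed

section \<open>Differential equations for the Gaussian moments\<close>

text \<open>The integrand is the derivative of \<open>?F\<close>, which vanishes at both infinities.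
  For \<open>k = 0\<close> the truncated exponent \<open>k - 1\<close> is harmless, since its term
  carries the factor \<open>of_nat k\<close>.\<close>

lemma integral_deriv_gaussian_0:
  assumes s: "Re s > 0"
  shows "(LBINT x. (of_nat k * of_real x ^ (k - 1) + of_real x ^ k * (b - 2 * s * of_real x))
    * exp (b * of_real x - s * of_real x ^ 2)) = (0 :: complex)" (is "integral\<^sup>L _ ?f = 0")
proof -
  let ?F = "\<lambda>x. of_real x ^ k * exp (b * of_real x - s * of_real x ^ 2) :: complex"
  have fi: "integrable lborel ?f"
  proof -
    have "?f = (\<lambda>x. of_nat k * (of_real x ^ (k - 1) * exp (b * of_real x - s * of_real x ^ 2))
        + b * ?F x - 2 * s * (of_real x ^ (k + 1) * exp (b * of_real x - s * of_real x ^ 2)))"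
      by (auto simp: fun_eq_iff algebra_simps)
    then show ?thesis
      by (auto intro!: Bochner_Integration.integrable_add Bochner_Integration.integrable_diff
          integrable_mult_right integrable_gaussian s simp del: power_Suc)
  qed
  have "(LBINT x=-\<infinity>..\<infinity>. ?f x) = 0 - 0"
  proof (rule interval_integral_FTC_integrable)
    show "(?F has_vector_derivative ?f x) (at x)" for x
      by (rule has_vector_derivative_real_field) (auto intro!: derivative_eq_intros simp: algebra_simps power2_eq_square)
    show "isCont ?f x" for x
      by (intro continuous_intros)
    show "set_integrable lborel (einterval (-\<infinity>) \<infinity>) ?f"
      using fi by (simp add: set_integrable_def)
    show "((?F \<circ> real_of_ereal) \<longlongrightarrow> 0) (at_right (-\<infinity>))"
      unfolding ereal_tendsto_simps1 by (rule gaussian_tendsto_0[OF s filterlim_pow_at_bot_even]) (auto simp: filterlim_ident)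
    show "((?F \<circ> real_of_ereal) \<longlongrightarrow> 0) (at_left \<infinity>)"
      unfolding ereal_tendsto_simps1 by (rule gaussian_tendsto_0[OF s filterlim_pow_at_top]) (auto simp: filterlim_ident)
  qed simp
  then show ?thesis
    by (simp add: interval_integral_to_infinity_eq interval_lebesgue_integral_def set_lebesgue_integral_def)
qed

text \<open>Integration by parts with \<open>k = 0\<close>. Since the first moment is the derivative
  of the zeroth in \<open>b\<close>, this is a linear differential equation in
  \<open>b\<close>.\<close>

lemma gaussian_moment_1:
  assumes s: "Re s > 0"
  shows "2 * s * gaussian_moment 1 s b = b * gaussian_moment 0 s b"
proof -
  have "0 = (LBINT x. b * (of_real x ^ 0 * exp (b * of_real x - s * of_real x ^ 2))
      - 2 * s * (of_real x ^ 1 * exp (b * of_real x - s * of_real x ^ 2)))"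
    using integral_deriv_gaussian_0[OF s, of 0 b] by (simp add: algebra_simps)
  also have "\<dots> = b * gaussian_moment 0 s b - 2 * s * gaussian_moment 1 s b"
    unfolding gaussian_moment_def
    by (subst Bochner_Integration.integral_diff) (use integrable_gaussian[OF s, of 0 b] integrable_gaussian[OF s, of 1 b] in simp_all)
  finally show ?thesis by simp
qed

text \<open>Integration by parts with \<open>k = 1\<close> and \<open>b = 0\<close>. Since minus the
  second moment is the derivative of the zeroth in \<open>s\<close>, this is a differential equation
  in \<open>s\<close>.\<close>

lemma gaussian_moment_2:
  assumes s: "Re s > 0"
  shows "2 * s * gaussian_moment 2 s 0 = gaussian_moment 0 s 0"
proof -
  have "0 = (LBINT x. (of_real x ^ 0 * exp (0 * of_real x - s * of_real x ^ 2))
      - 2 * s * (of_real x ^ 2 * exp (0 * of_real x - s * of_real x ^ 2)))"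
    using integral_deriv_gaussian_0[OF s, of 1 0] by (simp add: algebra_simps power2_eq_square)
  also have "\<dots> = gaussian_moment 0 s 0 - 2 * s * gaussian_moment 2 s 0"
    unfolding gaussian_moment_def
    by (subst Bochner_Integration.integral_diff) (use integrable_gaussian[OF s, of 0 0] integrable_gaussian[OF s, of 2 0] in simp_all)
  finally show ?thesis by simp
qed

lemma DERIV_gaussian_moment_linear:
  assumes s: "Re s > 0"
  shows "((\<lambda>b. gaussian_moment k s b) has_field_derivative gaussian_moment (Suc k) s b) (at b)"
  unfolding gaussian_moment_def
\<comment> \<open>On this ball the linear coefficient stays below \<open>norm b + 1\<close>, so
  \<open>norm_gaussian_le\<close> gives one dominating function for all of it.\<close>
proof (rule has_field_derivative_lebesgue_integral[where S = "ball 0 (norm b + 1)"])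
  show "integrable lborel (\<lambda>x. fact (Suc k) * exp (((norm b + 1) + 1)\<^sup>2 / (2 * Re s)) * exp (- (Re s / 2) * x\<^sup>2))"
    using s by (intro integrable_mult_right integrable_exp_neg_square) auto
  show "norm (of_real x ^ Suc k * exp (w * of_real x - s * of_real x ^ 2))
      \<le> fact (Suc k) * exp (((norm b + 1) + 1)\<^sup>2 / (2 * Re s)) * exp (- (Re s / 2) * x\<^sup>2)"
    if "w \<in> ball 0 (norm b + 1)" for w x
    using that s by (intro norm_gaussian_le) auto
  show "((\<lambda>w. of_real x ^ k * exp (w * of_real x - s * of_real x ^ 2)) has_field_derivative
      of_real x ^ Suc k * exp (w * of_real x - s * of_real x ^ 2)) (at w)" for w and x :: real
    by (auto intro!: derivative_eq_intros)
  show "integrable lborel (\<lambda>x. of_real x ^ k * exp (w * of_real x - s * of_real x ^ 2) :: complex)" for w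
    by (rule integrable_gaussian[OF s])
  show "b \<in> ball 0 (norm b + 1)" "open (ball (0::complex) (norm b + 1))" "convex (ball (0::complex) (norm b + 1))"
    by simp_all
  show "(\<lambda>x. of_real x ^ Suc k * exp (b * of_real x - s * of_real x ^ 2) :: complex) \<in> borel_measurable lborel"
    by measurable
qed

lemma DERIV_gaussian_moment_quadratic:
  assumes s: "Re s > 0"
  shows "((\<lambda>s. gaussian_moment k s b) has_field_derivative - gaussian_moment (k + 2) s b) (at s)"
proof -
  let ?f = "\<lambda>s x. - (of_real x ^ (k + 2) * exp (b * of_real x - s * of_real x ^ 2)) :: complex"
  have "((\<lambda>s. gaussian_moment k s b) has_field_derivative (LBINT x. ?f s x)) (at s)"
    unfolding gaussian_moment_def
  \<comment> \<open>Halving \<open>Re s\<close> leaves an open half-plane around \<open>s\<close> on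
    which the decay rate is bounded below.\<close>
  proof (rule has_field_derivative_lebesgue_integral[where S = "{w. Re s / 2 < Re w}"])
    show "integrable lborel (\<lambda>x. fact (k + 2) * exp ((norm b + 1)\<^sup>2 / (2 * (Re s / 2))) * exp (- (Re s / 2 / 2) * x\<^sup>2))"
      using s by (intro integrable_mult_right integrable_exp_neg_square) auto
    show "norm (?f w x) \<le> fact (k + 2) * exp ((norm b + 1)\<^sup>2 / (2 * (Re s / 2))) * exp (- (Re s / 2 / 2) * x\<^sup>2)"
      if "w \<in> {w. Re s / 2 < Re w}" for w x
      unfolding norm_minus_cancel using that s by (intro norm_gaussian_le) auto
    show "integrable lborel (\<lambda>x. of_real x ^ k * exp (b * of_real x - w * of_real x ^ 2) :: complex)"
      if "w \<in> {w. Re s / 2 < Re w}" for w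
      using that s by (intro integrable_gaussian) auto
  qed (use s in \<open>auto intro!: derivative_eq_intros open_halfspace_Re_gt convex_halfspace_Re_gt
      simp: power_add power2_eq_square simp del: divide_less_eq_numeral1\<close>)
  then show ?thesis by (simp add: gaussian_moment_def)
qed

text \<open>Instead of shifting a contour to complete the square, one checks that
  \<open>exp (- (b\<^sup>2 / (4 * s)))\<close> times the zeroth moment has derivative zero in
  \<open>b\<close>, and compares with \<open>b = 0\<close>.\<close>

lemma gaussian_moment_0_shift:
  assumes s: "Re s > 0"
  shows "gaussian_moment 0 s b = exp (b\<^sup>2 / (4 * s)) * gaussian_moment 0 s 0"
proof -
  have "((\<lambda>b. exp (- (b\<^sup>2 / (4 * s))) * gaussian_moment 0 s b) has_field_derivative 0) (at b)" for b
  proof -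
    have "s \<noteq> 0" using s by auto
    then have "gaussian_moment (Suc 0) s b = b / (2 * s) * gaussian_moment 0 s b"
      using gaussian_moment_1[OF s, of b] by (simp add: field_simps)
    then show ?thesis
      using \<open>s \<noteq> 0\<close> by (auto intro!: derivative_eq_intros DERIV_gaussian_moment_linear s simp: field_simps)
  qed
  then obtain c where "exp (- (b\<^sup>2 / (4 * s))) * gaussian_moment 0 s b = c" for b
    using has_field_derivative_zero_constant[of UNIV "\<lambda>b. exp (- (b\<^sup>2 / (4 * s))) * gaussian_moment 0 s b"]
    by auto
  from this[of b] this[of 0] show ?thesis
    by (simp add: exp_minus field_simps)
qed

text \<open>
  Each complex coordinate contributes two real Gaussian integrals with the same quadratic coefficient,
  so that only the square is needed and no branch of the square root has to be chosen.
\<close>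

lemma gaussian_moment_0_square:
  assumes s: "Re s > 0"
  shows "(gaussian_moment 0 s 0)\<^sup>2 = of_real pi / s"
proof -
  \<comment> \<open>The zeroth moment M satisfies M' = - M / (2 s), so s M^2 is constant on the
    right half-plane.\<close>
  let ?F = "\<lambda>s. s * (gaussian_moment 0 s 0)\<^sup>2"
  have "\<exists>c. \<forall>w\<in>{w. 0 < Re w}. ?F w = c"
  proof (rule has_field_derivative_zero_constant[OF convex_halfspace_Re_gt])
    fix w assume "w \<in> {w. 0 < Re w}"
    then have "Re w > 0" by simp
    moreover from gaussian_moment_2[OF this]
    have "(gaussian_moment 0 w 0)\<^sup>2 = 2 * w * gaussian_moment 2 w 0 * gaussian_moment 0 w 0"
      by (simp add: power2_eq_square)
    ultimately have "(?F has_field_derivative 0) (at w)"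
      by (auto intro!: derivative_eq_intros DERIV_gaussian_moment_quadratic simp: numeral_2_eq_2)
    then show "(?F has_field_derivative 0) (at w within {w. 0 < Re w})"
      by (rule has_field_derivative_at_within)
  qed
  then obtain c where c: "\<And>w. 0 < Re w \<Longrightarrow> ?F w = c" by auto
  \<comment> \<open>The constant is read off at \<open>s = 1/2\<close>, where the integrand is the
    unnormalised standard normal density.\<close>
  have "gaussian_moment 0 (1/2) 0 = of_real (LBINT x. sqrt (2 * pi) * std_normal_density x)"
    unfolding gaussian_moment_def integral_complex_of_real[symmetric]
    by (intro Bochner_Integration.integral_cong) (auto simp: std_normal_density_def exp_of_real[symmetric])
  then have "gaussian_moment 0 (1/2) 0 = of_real (sqrt (2 * pi))"
    by simp
  then have "?F (1/2) = pi"
    by (simp flip: of_real_power)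
  then have "?F s = pi"
    using c[of "1/2"] c[OF s] by simp
  then show ?thesis
    using s by (subst nonzero_eq_divide_eq) (auto simp: mult.commute)
qed

section \<open>From one real variable to several complex variables\<close>

text \<open>Fubini for products of one-variable functions: \<open>lborel\<close> is the image of the
  product measure under the map \<open>?T\<close> that assembles a vector from its
  coordinates.\<close>

lemma has_bochner_integral_lborel_prod:
  fixes f :: "'a::euclidean_space \<Rightarrow> real \<Rightarrow> complex"
  assumes f: "\<And>b. b \<in> Basis \<Longrightarrow> integrable lborel (f b)"
  shows "has_bochner_integral lborel (\<lambda>x. \<Prod>b\<in>Basis. f b (x \<bullet> b)) (\<Prod>b\<in>Basis. LBINT x. f b x)"
proof -
  interpret product_sigma_finite "\<lambda>_::'a. lborel :: real measure" ..
  let ?T = "\<lambda>g::'a \<Rightarrow> real. \<Sum>b\<in>Basis. g b *\<^sub>R b"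
  have [measurable]: "f b \<in> borel_measurable borel" if "b \<in> Basis" for b
    using borel_measurable_integrable[OF f[OF that]] by simp
  have F: "(\<lambda>x. \<Prod>b\<in>Basis. f b (x \<bullet> b)) \<in> borel_measurable borel"
    by measurable
  have T: "?T \<in> measurable (\<Pi>\<^sub>M b\<in>Basis. lborel) borel"
    by measurable
  have eq: "(\<Prod>b\<in>Basis. f b (?T g \<bullet> b)) = (\<Prod>b\<in>Basis. f b (g b))" for g
    by (intro prod.cong refl) (simp add: inner_sum_left inner_Basis if_distrib sum.delta cong: if_cong)
  show ?thesis
    unfolding has_bochner_integral_iff
  proof
    show "integrable lborel (\<lambda>x. \<Prod>b\<in>Basis. f b (x \<bullet> b))"
      by (subst lborel_eq, subst integrable_distr_eq[OF T F], unfold eq)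
        (intro product_integrable_prod f finite_Basis)
    show "(LBINT x. \<Prod>b\<in>Basis. f b (x \<bullet> b)) = (\<Prod>b\<in>Basis. LBINT x. f b x)"
      by (subst lborel_eq, subst integral_distr[OF T F], unfold eq)
        (intro product_integral_prod f finite_Basis)
  qed
qed

text \<open>The real basis splits into disjoint pairs, the real and the imaginary direction of each
  complex coordinate; this groups the real Gaussian factors accordingly.\<close>

lemma prod_Basis_complex_vec:
  fixes h :: "complex^'n \<Rightarrow> 'b::comm_monoid_mult"
  shows "(\<Prod>b\<in>Basis. h b) = (\<Prod>k\<in>UNIV. h (axis k 1) * h (axis k \<i>))"
proof -
  have "(\<Prod>b\<in>Basis. h b) = (\<Prod>k\<in>UNIV. \<Prod>b\<in>(\<Union>u\<in>Basis. {axis k u}). h b)"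
    unfolding Basis_vec_def by (rule prod.UNION_disjoint) (auto simp: axis_eq_axis nonzero_Basis)
  also have "\<dots> = (\<Prod>k\<in>UNIV. h (axis k 1) * h (axis k \<i>))"
    by (intro prod.cong refl) (simp add: Basis_complex_def axis_eq_axis mult.commute)
  finally show ?thesis .
qed

lemma has_bochner_integral_mu:
  fixes f :: "complex^'n \<Rightarrow> complex"
  assumes lam: "lam > 0" and f: "has_bochner_integral lborel f I"
  shows "has_bochner_integral (mu lam) f (of_real ((lam / (2 * pi)) ^ CARD('n)) * I)"
  unfolding mu_def
proof (rule has_bochner_integral_density)
  have "has_bochner_integral lborel (\<lambda>x. of_real ((lam / (2 * pi)) ^ CARD('n)) * f x) (of_real ((lam / (2 * pi)) ^ CARD('n)) * I)"
    using f by (intro has_bochner_integral_mult_right)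
  moreover have "(2 * pi) powi - int CARD('n) * lam ^ CARD('n) = (lam / (2 * pi)) ^ CARD('n)"
    by (simp only: power_int_minus power_int_of_nat power_divide) (simp only: divide_inverse mult.commute)
  ultimately show "has_bochner_integral lborel (\<lambda>x. ((2 * pi) powi - int CARD('n) * lam ^ CARD('n)) *\<^sub>R f x)
      (of_real ((lam / (2 * pi)) ^ CARD('n)) * I)"
    by (simp only: scaleR_conv_of_real)
qed (use f lam in \<open>auto simp: has_bochner_integral_iff\<close>)

text \<open>The two real directions of coordinate \<open>k\<close> have the same quadratic
  coefficient, and their linear coefficients have squares summing to a multiple of
  \<open>b $ k * c $ k\<close>. The constant in \<open>mu\<close> cancels the remaining powers of
  \<open>2 * pi / lam\<close>.\<close>

lemma has_bochner_integral_gaussian_Cn: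
  fixes s :: "'n::finite \<Rightarrow> complex" and b c :: "complex^'n"
  assumes lam: "lam > 0" and s: "\<And>k. Re (s k) > 0"
  shows "has_bochner_integral (mu lam)
    (\<lambda>w. exp (of_real lam / 2 * (\<Sum>k\<in>UNIV. b $ k * w $ k + c $ k * cnj (w $ k) - s k * (w $ k * cnj (w $ k)))))
    ((\<Prod>k\<in>UNIV. inverse (s k)) * exp (of_real lam / 2 * (\<Sum>k\<in>UNIV. b $ k * c $ k / s k)))"
proof -
  \<comment> \<open>\<open>S e\<close> and \<open>B e\<close> are the quadratic and linear
    coefficients of the exponent along a real basis vector \<open>e\<close>.\<close>
  define S where "S e = of_real lam / 2 * (\<Sum>k\<in>UNIV. s k * (e $ k * cnj (e $ k)))" for e :: "complex^'n"
  define B where "B e = of_real lam / 2 * (\<Sum>k\<in>UNIV. b $ k * e $ k + c $ k * cnj (e $ k))" for e :: "complex^'n"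
  define f where "f e x = exp (B e * of_real x - S e * of_real x ^ 2)" for e and x :: real
  have s0: "s k \<noteq> 0" for k using s[of k] by auto
  have S: "S (axis k u) = of_real lam / 2 * s k * (u * cnj u)" for k u
    by (simp add: S_def axis_def if_distrib[where f = "\<lambda>x. x * _"] if_distrib[where f = "\<lambda>x. _ * x"] if_distrib[where f = cnj] cong: if_cong)
  have B: "B (axis k u) = of_real lam / 2 * (b $ k * u + c $ k * cnj u)" for k u
    by (simp add: B_def sum.distrib axis_def if_distrib[where f = "\<lambda>x. x * _"] if_distrib[where f = "\<lambda>x. _ * x"] if_distrib[where f = cnj] cong: if_cong)
  have Re_S: "Re (S e) > 0" if "e \<in> Basis" for e
    using that lam s by (auto simp: Basis_vec_def Basis_complex_def S)
  have "has_bochner_integral lborel (\<lambda>w. \<Prod>e\<in>Basis. f e (w \<bullet> e)) (\<Prod>e\<in>Basis. LBINT x. f e x)"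
    using integrable_gaussian[OF Re_S, of _ 0] by (intro has_bochner_integral_lborel_prod) (simp add: f_def)
  also have "(\<lambda>w. \<Prod>e\<in>Basis. f e (w \<bullet> e)) =
    (\<lambda>w. exp (of_real lam / 2 * (\<Sum>k\<in>UNIV. b $ k * w $ k + c $ k * cnj (w $ k) - s k * (w $ k * cnj (w $ k)))))"
  proof
    fix w :: "complex^'n"
    have "f (axis k 1) (w \<bullet> axis k 1) * f (axis k \<i>) (w \<bullet> axis k \<i>) =
        exp (of_real lam / 2 * (b $ k * w $ k + c $ k * cnj (w $ k) - s k * (w $ k * cnj (w $ k))))" for k
    proof -
      obtain x y where w: "w $ k = Complex x y" by (cases "w $ k")
      have c: "Complex x y = of_real x + \<i> * of_real y" "cnj (Complex x y) = of_real x - \<i> * of_real y"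
        by (simp_all add: complex_eq_iff)
      show ?thesis
        by (simp add: f_def S B inner_axis w flip: exp_add) (simp add: c algebra_simps power2_eq_square add_divide_distrib diff_divide_distrib)
    qed
    then show "(\<Prod>e\<in>Basis. f e (w \<bullet> e)) =
      exp (of_real lam / 2 * (\<Sum>k\<in>UNIV. b $ k * w $ k + c $ k * cnj (w $ k) - s k * (w $ k * cnj (w $ k))))"
      by (simp only: prod_Basis_complex_vec sum_distrib_left exp_sum finite)
  qed
  also have "(\<Prod>e\<in>Basis. LBINT x. f e x) =
    (\<Prod>k\<in>UNIV. of_real (2 * pi / lam) * (inverse (s k) * exp (of_real lam / 2 * (b $ k * c $ k / s k))))"
    unfolding prod_Basis_complex_vec
  proof (intro prod.cong refl)
    fix k
    let ?S = "of_real lam / 2 * s k"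
    have "(LBINT x. f e x) = exp ((B e)\<^sup>2 / (4 * S e)) * gaussian_moment 0 (S e) 0" if "e \<in> Basis" for e
      using gaussian_moment_0_shift[OF Re_S[OF that], of "B e"] by (simp add: gaussian_moment_def f_def)
    then have "(LBINT x. f (axis k 1) x) * (LBINT x. f (axis k \<i>) x) =
      exp (((B (axis k 1))\<^sup>2 + (B (axis k \<i>))\<^sup>2) / (4 * ?S)) * (gaussian_moment 0 ?S 0)\<^sup>2"
      by (simp add: Basis_complex_def S add_divide_distrib exp_add power2_eq_square)
    \<comment> \<open>The linear coefficients are \<open>lam / 2\<close> times b + c and i (b - c),
      and (b + c)^2 - (b - c)^2 = 4 b c.\<close>
    also have "(B (axis k 1))\<^sup>2 + (B (axis k \<i>))\<^sup>2 = (of_real lam)\<^sup>2 * (b $ k * c $ k)"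
      by (simp add: B power2_eq_square algebra_simps)
    also have "\<dots> / (4 * ?S) = of_real lam / 2 * (b $ k * c $ k / s k)"
      using lam s0[of k] by (simp add: field_simps power2_eq_square)
    also have "(gaussian_moment 0 ?S 0)\<^sup>2 = of_real (2 * pi / lam) * inverse (s k)"
      using gaussian_moment_0_square[of ?S] lam s[of k] s0[of k] by (simp add: field_simps)
    finally show "(LBINT x. f (axis k 1) x) * (LBINT x. f (axis k \<i>) x) =
        of_real (2 * pi / lam) * (inverse (s k) * exp (of_real lam / 2 * (b $ k * c $ k / s k)))"
      by (simp add: mult_ac)
  qed
  also have "\<dots> = of_real (2 * pi / lam) ^ CARD('n) *
      ((\<Prod>k\<in>UNIV. inverse (s k)) * exp (of_real lam / 2 * (\<Sum>k\<in>UNIV. b $ k * c $ k / s k)))"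
    by (simp only: prod.distrib prod_constant sum_distrib_left exp_sum finite)
  finally have "has_bochner_integral (mu lam)
    (\<lambda>w. exp (of_real lam / 2 * (\<Sum>k\<in>UNIV. b $ k * w $ k + c $ k * cnj (w $ k) - s k * (w $ k * cnj (w $ k)))))
    (of_real ((lam / (2 * pi)) ^ CARD('n)) * (of_real (2 * pi / lam) ^ CARD('n) *
      ((\<Prod>k\<in>UNIV. inverse (s k)) * exp (of_real lam / 2 * (\<Sum>k\<in>UNIV. b $ k * c $ k / s k)))))"
    by (rule has_bochner_integral_mu[OF lam])
  moreover have "complex_of_real ((lam / (2 * pi)) ^ CARD('n)) * of_real (2 * pi / lam) ^ CARD('n) = 1"
  proof -
    have "lam / (2 * pi) * (2 * pi / lam) = 1"
      using lam by simp
    then show ?thesis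
      by (simp only: of_real_power of_real_mult[symmetric] power_mult_distrib[symmetric]) simp
  qed
  ultimately show ?thesis
    by (simp only: mult.assoc[symmetric] mult_1_left)
qed

subsection \<open>Coherent states and the Weyl symbol\<close>

lemma vcnj_nth [simp]: "vcnj z $ k = cnj (z $ k)"
  by (simp add: vcnj_def)

lemma of_real_norm_square_Cn: "complex_of_real ((norm z)\<^sup>2) = (\<Sum>k\<in>UNIV. z $ k * cnj (z $ k))"
  using bil_vcnj_self[of z] by (simp add: bil_def)

lemma bounded_linear_bil: "bounded_linear (\<lambda>v. a \<odot> v)"
  unfolding bil_def by (intro bounded_linear_sum bounded_linear_const_mult bounded_linear_vec_nth)

lemma holomorphic_Cn_coherent:
  fixes w :: "complex^'n::finite"
  shows "holomorphic_Cn (coherent lam w)"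
  unfolding holomorphic_Cn_def
proof (intro allI exI conjI)
  fix z v :: "complex^'n" and c
  show "(coherent lam w has_derivative (\<lambda>v. coherent lam w z * (of_real lam * (vcnj w \<odot> v) / 2))) (at z)"
  proof -
    have "bounded_linear (\<lambda>v. of_real lam * (vcnj w \<odot> v) / 2)"
      using bounded_linear_const_mult[OF bounded_linear_bil, of "of_real lam / 2" "vcnj w"] by simp
    from has_derivative_compose[OF bounded_linear_imp_has_derivative[OF this] DERIV_exp[unfolded has_field_derivative_def]]
    show ?thesis
      unfolding coherent_def .
  qed
  have "vcnj w \<odot> (c *s v) = c * (vcnj w \<odot> v)"
    by (simp add: bil_def sum_distrib_left mult_ac)
  then show "coherent lam w z * (of_real lam * (vcnj w \<odot> (c *s v)) / 2) =
      c * (coherent lam w z * (of_real lam * (vcnj w \<odot> v) / 2))"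
    by simp
qed

text \<open>The weighted square modulus is a Gaussian with all \<open>s k = 1\<close>. Membership is
  needed because \<open>pi_rep\<close> is specified only on \<open>fock lam\<close>.\<close>

lemma coherent_in_fock:
  assumes lam: "lam > 0"
  shows "coherent lam w \<in> fock lam"
  unfolding fock_def
proof (intro CollectI conjI holomorphic_Cn_coherent)
  let ?f = "\<lambda>z. exp (of_real lam / 2 * (\<Sum>k\<in>UNIV. vcnj w $ k * z $ k + w $ k * cnj (z $ k) - 1 * (z $ k * cnj (z $ k))))"
  have "?f z = of_real ((norm (coherent lam w z))\<^sup>2 * exp (- lam * (norm z)\<^sup>2 / 2))" for z
  proof -
    have "of_real ((norm (coherent lam w z))\<^sup>2 * exp (- lam * (norm z)\<^sup>2 / 2)) =
      coherent lam w z * cnj (coherent lam w z) * exp (of_real (- lam / 2) * of_real ((norm z)\<^sup>2))"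
      by (simp add: complex_norm_square[symmetric] exp_of_real[symmetric])
    also have "\<dots> = ?f z"
      unfolding of_real_norm_square_Cn
      by (simp add: coherent_def bil_def exp_cnj sum.distrib sum_subtractf algebra_simps flip: exp_add)
    finally show ?thesis by simp
  qed
  moreover have "integrable (mu lam) ?f"
    using has_bochner_integral_gaussian_Cn[OF lam, of "\<lambda>_. 1" "vcnj w" w]
    unfolding has_bochner_integral_iff by simp
  ultimately show "integrable (mu lam) (\<lambda>z. (norm (coherent lam w z))\<^sup>2 * exp (- lam * (norm z)\<^sup>2 / 2))"
    by (simp only: complex_of_real_integrable_eq)
qed

section \<open>Kernel and Weyl symbol of the representation operators\<close>

text \<open>The defining inner product is a Gaussian integral with \<open>s k = 1\<close>, linear
  coefficients \<open>?b\<close> and antilinear coefficients \<open>x\<close>, so its value is the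
  exponential of the pairing of \<open>?b\<close> with \<open>x\<close>. The numbers
  \<open>u k\<close> are the diagonal entries of \<open>Amat \<alpha> (- t)\<close>.\<close>

lemma op_kernel_pi_rep:
  fixes \<alpha> :: "'n::finite \<Rightarrow> real^'m::finite \<Rightarrow> real" and t :: "real^'m"
  assumes lam: "lam > 0" and lin: "\<And>k. linear (\<alpha> k)"
  defines "u \<equiv> \<lambda>k. exp (- (\<i> * of_real (\<alpha> k t)))"
  shows "op_kernel lam (pi_rep \<alpha> chi lam (t, z0, c0)) x y =
    chi t * exp (\<i> * lam * c0 - lam / 4 * (norm z0)\<^sup>2) *
    exp (of_real lam / 2 * (\<Sum>k\<in>UNIV. (cnj (z0 $ k) + cnj (y $ k) * u k) * x $ k - cnj (y $ k) * u k * z0 $ k))"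
    (is "_ = ?C * exp (_ * ?E)")
proof -
  \<comment> \<open>The part of the exponent independent of \<open>w\<close> that comes from the
    translation by \<open>z0\<close>.\<close>
  let ?K = "\<Sum>k\<in>UNIV. cnj (y $ k) * u k * z0 $ k"
  let ?b = "\<chi> k. cnj (z0 $ k) + cnj (y $ k) * u k"
  let ?G = "\<lambda>w. exp (of_real lam / 2 * (\<Sum>k\<in>UNIV. ?b $ k * w $ k + x $ k * cnj (w $ k) - 1 * (w $ k * cnj (w $ k))))"
  have act: "act \<alpha> (- t) w $ k = u k * w $ k" for w k
    by (simp add: act_nth u_def linear_neg[OF lin])
  have "pi_rep \<alpha> chi lam (t, z0, c0) (coherent lam y) w * cnj (coherent lam x w) * of_real (exp (- lam * (norm w)\<^sup>2 / 2))
      = ?C * exp (- (of_real lam / 2 * ?K)) * ?G w" for w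
  proof -
    have "pi_rep \<alpha> chi lam (t, z0, c0) (coherent lam y) w =
        chi t * exp (\<i> * lam * c0 + lam / 2 * (vcnj z0 \<odot> w) - lam / 4 * (norm z0)\<^sup>2)
        * exp (lam * (vcnj y \<odot> act \<alpha> (- t) (w - z0)) / 2)"
      using coherent_in_fock[OF lam, of y] by (simp add: pi_rep_def) (simp add: coherent_def)
    then have "pi_rep \<alpha> chi lam (t, z0, c0) (coherent lam y) w * cnj (coherent lam x w) * of_real (exp (- lam * (norm w)\<^sup>2 / 2))
      = chi t * (exp (\<i> * lam * c0 + lam / 2 * (vcnj z0 \<odot> w) - lam / 4 * (norm z0)\<^sup>2) *
          exp (lam * (vcnj y \<odot> act \<alpha> (- t) (w - z0)) / 2) * exp (lam * (x \<odot> vcnj w) / 2) *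
          exp (of_real (- lam / 2) * of_real ((norm w)\<^sup>2)))"
      by (simp add: coherent_def exp_cnj bil_def exp_of_real[symmetric] mult_ac)
    also have "\<dots> = ?C * exp (- (of_real lam / 2 * ?K)) * ?G w"
      unfolding of_real_norm_square_Cn[of w] mult.assoc exp_add[symmetric]
      by (simp add: bil_def act sum.distrib sum_subtractf algebra_simps diff_divide_distrib flip: exp_add)
    finally show ?thesis .
  qed
  then have "op_kernel lam (pi_rep \<alpha> chi lam (t, z0, c0)) x y = ?C * exp (- (of_real lam / 2 * ?K)) * (LINT w|mu lam. ?G w)"
    unfolding op_kernel_def fock_inner_def by (simp only: integral_mult_right_zero)
  also have "(LINT w|mu lam. ?G w) = exp (of_real lam / 2 * (\<Sum>k\<in>UNIV. ?b $ k * x $ k))"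
    using has_bochner_integral_gaussian_Cn[OF lam, of "\<lambda>_. 1" ?b x]
    unfolding has_bochner_integral_iff by simp
  also have "?C * exp (- (of_real lam / 2 * ?K)) * \<dots> = ?C * exp (of_real lam / 2 * ?E)"
    unfolding mult.assoc exp_add[symmetric] by (simp add: sum_subtractf algebra_simps)
  finally show ?thesis .
qed

text \<open>Substituting \<open>z + w\<close> and \<open>z - w\<close> into the kernel gives
  \<open>- u k\<close> as coefficient of \<open>|w $ k|^2\<close>; the Weyl factor adds
  \<open>- 1\<close>, so the integrand is Gaussian in \<open>w\<close> with
  \<open>s k = 1 + u k\<close>. The factor \<open>2 ^ CARD('n)\<close> belongs to \<open>W0\<close>
  and is absent here.\<close>

lemma has_bochner_integral_weyl_integrand:
  fixes \<alpha> :: "'n::finite \<Rightarrow> real^'m::finite \<Rightarrow> real" and t :: "real^'m"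
  assumes lam: "lam > 0" and lin: "\<And>k. linear (\<alpha> k)"
    and pos: "\<And>k. Re (1 + exp (- (\<i> * of_real (\<alpha> k t)))) > 0"
  defines "u \<equiv> \<lambda>k. exp (- (\<i> * of_real (\<alpha> k t)))"
  shows "has_bochner_integral (mu lam) (weyl_integrand lam (pi_rep \<alpha> chi lam (t, z0, c0)) z)
    (chi t * exp (\<i> * lam * c0) * exp (- lam * (act \<alpha> (- t) z0 \<odot> vcnj z) - lam * (norm z)\<^sup>2 - lam / 4 * (norm z0)\<^sup>2)
     * (\<Prod>k\<in>UNIV. inverse (1 + u k))
     * exp (lam / 2 * (\<Sum>k\<in>UNIV. u k / (1 + u k) * of_real ((norm (u k * z0 $ k + 2 * z $ k))\<^sup>2))))"
proof -
  let ?C = "chi t * exp (\<i> * lam * c0 - lam / 4 * (norm z0)\<^sup>2)"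
  \<comment> \<open>Expansion of the exponent in \<open>w\<close>: \<open>?K\<close> is the constant
    term, \<open>?b\<close> and \<open>?c\<close> are the coefficients of \<open>w\<close> and of
    its conjugate.\<close>
  let ?K = "\<Sum>k\<in>UNIV. (cnj (z0 $ k) + cnj (z $ k) * u k) * z $ k - cnj (z $ k) * u k * z0 $ k - z $ k * cnj (z $ k)"
  let ?b = "\<chi> k. cnj (z0 $ k) + u k * cnj (z $ k) - cnj (z $ k)"
  let ?c = "\<chi> k. u k * z0 $ k - u k * z $ k + z $ k"
  let ?G = "\<lambda>w. exp (of_real lam / 2 * (\<Sum>k\<in>UNIV. ?b $ k * w $ k + ?c $ k * cnj (w $ k) - (1 + u k) * (w $ k * cnj (w $ k))))"
  have act: "act \<alpha> (- t) w $ k = u k * w $ k" for w k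
    by (simp add: act_nth u_def linear_neg[OF lin])
  have u: "u k * cnj (u k) = 1" "1 + u k \<noteq> 0" for k
  proof -
    show "u k * cnj (u k) = 1"
      by (simp add: u_def exp_cnj flip: exp_add)
    show "1 + u k \<noteq> 0"
      using pos[of k] unfolding u_def by (metis less_irrefl zero_complex.sel(1))
  qed
  have u_eq: "exp (- (\<i> * of_real (\<alpha> k t))) = u k" for k
    by (simp add: u_def)
  have weyl: "weyl_integrand lam (pi_rep \<alpha> chi lam (t, z0, c0)) z = (\<lambda>w. ?C * exp (of_real lam / 2 * ?K) * ?G w)"
    unfolding weyl_integrand_def op_kernel_pi_rep[OF lam lin] mult.assoc exp_add[symmetric]
    by (simp add: u_eq bil_def sum.distrib sum_subtractf sum_negf algebra_simps add_divide_distrib diff_divide_distrib fun_eq_iff)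
  \<comment> \<open>One coordinate of the final exponent. The relation \<open>v * cnj v = 1\<close>
    eliminates \<open>cnj v\<close>, after which the claim is an identity of fractions with
    denominator \<open>1 + v\<close>.\<close>
  have summand: "((cnj a + cnj x * v) * x - cnj x * v * a - x * cnj x) +
       (cnj a + v * cnj x - cnj x) * (v * a - v * x + x) / (1 + v) =
      - 2 * (v * a * cnj x) - 2 * (x * cnj x) + v / (1 + v) * of_real ((norm (v * a + 2 * x))\<^sup>2)"
    if "v * cnj v = 1" "1 + v \<noteq> 0" for a x v
  proof -
    have "of_real ((norm (v * a + 2 * x))\<^sup>2) = v * cnj v * a * cnj a + 2 * v * a * cnj x + 2 * cnj v * cnj a * x + 4 * x * cnj x"
      by (simp only: complex_norm_square) (simp add: algebra_simps)
    then have "v * of_real ((norm (v * a + 2 * x))\<^sup>2) = v * (v * cnj v) * a * cnj a + 2 * v\<^sup>2 * a * cnj x + 2 * (v * cnj v) * cnj a * x + 4 * v * x * cnj x"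
      by (simp add: algebra_simps power2_eq_square)
    also have "\<dots> = v * a * cnj a + 2 * v\<^sup>2 * a * cnj x + 2 * cnj a * x + 4 * v * x * cnj x"
      by (simp add: that)
    finally have *: "v * of_real ((norm (v * a + 2 * x))\<^sup>2) = \<dots>" .
    show ?thesis
      unfolding times_divide_eq_left * using that(2)
      by (simp add: divide_simps) (simp add: algebra_simps power2_eq_square)
  qed
  have "has_bochner_integral (mu lam) (\<lambda>w. ?C * exp (of_real lam / 2 * ?K) * ?G w)
    (?C * exp (of_real lam / 2 * ?K) *
      ((\<Prod>k\<in>UNIV. inverse (1 + u k)) * exp (of_real lam / 2 * (\<Sum>k\<in>UNIV. ?b $ k * ?c $ k / (1 + u k)))))"
    using pos by (intro has_bochner_integral_mult_right has_bochner_integral_gaussian_Cn lam) (simp add: u_def)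
  also have "?C * exp (of_real lam / 2 * ?K) *
      ((\<Prod>k\<in>UNIV. inverse (1 + u k)) * exp (of_real lam / 2 * (\<Sum>k\<in>UNIV. ?b $ k * ?c $ k / (1 + u k)))) =
     ?C * (\<Prod>k\<in>UNIV. inverse (1 + u k)) * exp (of_real lam / 2 * (?K + (\<Sum>k\<in>UNIV. ?b $ k * ?c $ k / (1 + u k))))"
    by (simp add: exp_add distrib_left mult_ac)
  also have "?K + (\<Sum>k\<in>UNIV. ?b $ k * ?c $ k / (1 + u k)) =
      - 2 * (act \<alpha> (- t) z0 \<odot> vcnj z) - 2 * of_real ((norm z)\<^sup>2) + (\<Sum>k\<in>UNIV. u k / (1 + u k) * of_real ((norm (u k * z0 $ k + 2 * z $ k))\<^sup>2))"
    unfolding of_real_norm_square_Cn[of z] bil_def sum_distrib_left sum_subtractf[symmetric] sum.distrib[symmetric]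
    by (intro sum.cong refl) (simp only: vec_lambda_beta vcnj_nth act summand[OF u])
  finally show ?thesis
    unfolding weyl by (simp add: exp_add[symmetric] algebra_simps)
qed

section \<open>Diagonal matrices and the condition on the angles\<close>

text \<open>\<open>matrix_inv\<close> is a Hilbert choice: \<open>B\<close> witnesses that a
  two-sided inverse exists, and associativity shows that it is unique.\<close>

lemma matrix_inv_eqI:
  fixes A B :: "'a::semiring_1^'n^'n"
  assumes "A ** B = mat 1" and "B ** A = mat 1"
  shows "matrix_inv A = B"
proof -
  have "A ** matrix_inv A = mat 1 \<and> matrix_inv A ** A = mat 1"
    unfolding matrix_inv_def by (rule someI[of _ B]) (use assms in simp)
  then have "matrix_inv A = matrix_inv A ** (A ** B)"
    by (simp add: assms)
  also have "\<dots> = B"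
    using \<open>A ** matrix_inv A = mat 1 \<and> matrix_inv A ** A = mat 1\<close> by (simp add: matrix_mul_assoc)
  finally show ?thesis .
qed

lemma matrix_inv_diagonal:
  fixes d :: "'n::finite \<Rightarrow> 'a::field"
  assumes "\<And>k. d k \<noteq> 0"
  shows "matrix_inv (\<chi> j k. if j = k then d j else 0) = (\<chi> j k. if j = k then inverse (d j) else 0)"
  by (rule matrix_inv_eqI)
    (auto simp: matrix_matrix_mult_def vec_eq_iff mat_def assms if_distrib[where f = "\<lambda>x. x * _"] cong: if_cong)

lemma one_plus_Amat: "mat 1 + Amat \<alpha> t = (\<chi> j k. if j = k then 1 + exp (\<i> * complex_of_real (\<alpha> j t)) else 0)"
  by (simp add: vec_eq_iff Amat_def mat_def)

lemma bil_mat_diagonal: "bil_mat z (\<chi> j k. if j = k then d j else 0) w = (\<Sum>k\<in>UNIV. z $ k * d k * w $ k)"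
  by (simp add: bil_mat_def if_distrib[where f = "\<lambda>x. x * _"] if_distrib[where f = "\<lambda>x. _ * x"] cong: if_cong)

text \<open>The real part is \<open>1 + cos x\<close>, which vanishes only at odd multiples of
  \<open>pi\<close>.\<close>

lemma Re_one_plus_exp_pos:
  fixes x :: real
  assumes "x \<notin> {pi + 2 * pi * real_of_int j | j. True}"
  shows "Re (1 + exp (- (\<i> * of_real x))) > 0"
proof -
  have "cos x \<noteq> -1"
  proof
    assume "cos x = -1"
    then have "cos (x - pi) = 1"
      by (simp add: cos_diff)
    then obtain j :: int where "x - pi = real_of_int j * 2 * pi"
      unfolding cos_one_2pi_int by blast
    then have "x = pi + 2 * pi * real_of_int j"
      by (simp add: algebra_simps)
    with assms show False by blast
  qed
  then have "- 1 < cos x"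
    using cos_ge_minus_one[of x] by linarith
  then show ?thesis
    by (simp add: Re_exp)
qed

section \<open>The two forms of the Weyl symbol\<close>

theorem proposition6p3:
  fixes \<alpha> :: "'n::finite \<Rightarrow> real^'m::finite \<Rightarrow> real"
    and chi :: "real^'m \<Rightarrow> complex"
    and lam :: real
    and t :: "real^'m" and z0 :: "complex^'n" and c0 :: real
    and z :: "complex^'n"
  assumes "lam > 0"
    and "\<And>k. linear (\<alpha> k)"
    and "unitary_character chi"
    and "(t, z0, c0) \<in> carrier (diamond_group \<alpha>)"
    and "\<And>k. \<alpha> k t \<notin> {pi + 2 * pi * real_of_int j | j. True}"
  shows "weyl_defined lam (pi_rep \<alpha> chi lam (t, z0, c0)) z \<and>
    W0 lam (pi_rep \<alpha> chi lam (t, z0, c0)) z =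
      2 ^ CARD('n) * chi t * exp (\<i> * lam * c0)
      * inverse (det (mat 1 + Amat \<alpha> (- t)))
      * exp (- lam * (act \<alpha> (- t) z0 \<odot> vcnj z) - lam * (norm z)\<^sup>2 - lam / 4 * (norm z0)\<^sup>2)
      * exp (lam / 2 * bil_mat (act \<alpha> (- t) z0 + 2 *s z)
          (matrix_inv (mat 1 + Amat \<alpha> t)) (vcnj (act \<alpha> (- t) z0 + 2 *s z))) \<and>
    W0 lam (pi_rep \<alpha> chi lam (t, z0, c0)) z =
      2 ^ CARD('n) * chi t * exp (\<i> * lam * c0)
      * exp (- lam * (act \<alpha> (- t) z0 \<odot> vcnj z) - lam * (norm z)\<^sup>2 - lam / 4 * (norm z0)\<^sup>2)
      * (\<Prod>k\<in>UNIV. inverse (1 + exp (- \<i> * \<alpha> k t)))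
      * exp (lam / 2 * (\<Sum>k\<in>UNIV. inverse (1 + exp (\<i> * \<alpha> k t))
          * (norm (exp (- \<i> * \<alpha> k t) * z0 $ k + 2 * z $ k))\<^sup>2))"
    (is "_ \<and> ?W = ?R1 \<and> ?W = ?R2")
proof -
  note lin = assms(2)
  have pos: "Re (1 + exp (- (\<i> * of_real (\<alpha> k t)))) > 0" for k
    by (rule Re_one_plus_exp_pos[OF assms(5)])
  have neq: "1 + exp (- (\<i> * of_real (\<alpha> k t))) \<noteq> 0" for k
    using pos[of k] by (metis less_irrefl zero_complex.sel(1))
  \<comment> \<open>Dividing numerator and denominator by the exponential turns the coefficient u /
    (1 + u) of the Gaussian computation into the one of the stated formula.\<close>
  have frac: "exp (- (\<i> * of_real (\<alpha> k t))) / (1 + exp (- (\<i> * of_real (\<alpha> k t)))) = inverse (1 + exp (\<i> * of_real (\<alpha> k t)))" for k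
    using neq[of k] by (simp add: exp_minus field_simps)
  have neq': "1 + exp (\<i> * of_real (\<alpha> k t)) \<noteq> 0" for k
    using neq[of k] by (auto simp: exp_minus field_simps)
  note W = has_bochner_integral_weyl_integrand[where chi = chi and ?z0.0 = z0 and ?c0.0 = c0 and z = z, OF assms(1) lin pos]
  have "weyl_defined lam (pi_rep \<alpha> chi lam (t, z0, c0)) z"
    using W by (simp add: weyl_defined_def has_bochner_integral_iff)
  moreover have "?W = ?R2"
    using has_bochner_integral_integral_eq[OF W] by (simp add: W0_def frac mult_ac)
  \<comment> \<open>All matrices are diagonal: the determinant is a product of the entries, and the
    bilinear form is a sum in which v d cnj(v) becomes d |v|^2.\<close>
  moreover have "?R1 = ?R2"
  proof -
    have "det (mat 1 + Amat \<alpha> (- t)) = (\<Prod>k\<in>UNIV. 1 + exp (- \<i> * \<alpha> k t))"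
      by (simp add: one_plus_Amat det_diagonal linear_neg[OF lin])
    moreover have "bil_mat (act \<alpha> (- t) z0 + 2 *s z) (matrix_inv (mat 1 + Amat \<alpha> t)) (vcnj (act \<alpha> (- t) z0 + 2 *s z)) =
        (\<Sum>k\<in>UNIV. inverse (1 + exp (\<i> * \<alpha> k t)) * (norm (exp (- \<i> * \<alpha> k t) * z0 $ k + 2 * z $ k))\<^sup>2)"
    proof -
      have "(act \<alpha> (- t) z0 + 2 *s z) $ k = exp (- \<i> * \<alpha> k t) * z0 $ k + 2 * z $ k" for k
        by (simp add: act_nth linear_neg[OF lin])
      moreover have "v * d * cnj v = d * of_real ((norm v)\<^sup>2)" for v d
        by (simp add: complex_norm_square[symmetric] mult_ac flip: of_real_power)
      ultimately show ?thesis
        by (simp only: one_plus_Amat matrix_inv_diagonal[OF neq'] bil_mat_diagonal vcnj_nth)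
    qed
    ultimately show ?thesis
      by (simp only: prod_inversef[symmetric] o_def mult_ac)
  qed
  ultimately show ?thesis
    by (simp only: simp_thms)
qed

end
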